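(* For every integer $n\ge2$, the constant $\varepsilon_n$ defined in the context satisfies $$\frac1{110n(n+2)^2}<\varepsilon_n<\frac1{104n(n+2)^2}.$$ Consequently, $\varepsilon_n>\frac1{440n^3}$.
   Context: Definition of $\varepsilon_n$ for $n\ge 2$. Put $\gamma_2=\frac32$ and $\gamma_n=\frac{n+3+\sqrt{17n^2-26n+9}}{2n}$ for $n\ge3$; $L_n=13+\gamma_n$; $D_n=\frac{\sqrt{L_n}+\sqrt3}{\sqrt2}$; $E_n=\frac{1+2D_n}{6}$; $\sigma_n=\frac1{\sqrt{2n(n+2)}}$; $P_n(t)=\sigma_n-E_nt-\frac{t^2}{16n}$; and let $r_n=\frac{2\sigma_n}{E_n+\sqrt{E_n^2+\sigma_n/(4n)}}$ be the positive zero of $P_n$. Then $$\varepsilon_n=n\int_0^{r_n}tP_n(t)^2\cos\!\left(\sqrt{\tfrac{3}{2n}}\,t\right)\left[\frac{\sin\!\left(\sqrt{\tfrac{n+1}{2n}}\,t\right)}{\sqrt{\tfrac{n+1}{2n}}\,t}\right]^{n-1}dt,$$ the sine quotient being interpreted as $1$ at $t=0$. *)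

theory Defs
  imports "HOL-Probability.Sinc_Integral"
begin

definition gamma_n :: "nat \<Rightarrow> real" where
  "gamma_n n = (if n = 2 then 3 / 2
     else (real n + 3 + sqrt (17 * real n ^ 2 - 26 * real n + 9)) / (2 * real n))"

definition L_n :: "nat \<Rightarrow> real" where
  "L_n n = 13 + gamma_n n"

definition D_n :: "nat \<Rightarrow> real" where
  "D_n n = (sqrt (L_n n) + sqrt 3) / sqrt 2"

definition E_n :: "nat \<Rightarrow> real" where
  "E_n n = (1 + 2 * D_n n) / 6"

definition sigma_n :: "nat \<Rightarrow> real" where
  "sigma_n n = 1 / sqrt (2 * real n * (real n + 2))"

definition P_n :: "nat \<Rightarrow> real \<Rightarrow> real" where
  "P_n n t = sigma_n n - E_n n * t - t ^ 2 / (16 * real n)"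

definition r_n :: "nat \<Rightarrow> real" where
  "r_n n = 2 * sigma_n n / (E_n n + sqrt (E_n n ^ 2 + sigma_n n / (4 * real n)))"

text \<open>
  The library's \<^term>\<open>sinc x\<close> is \<^term>\<open>sin x / x\<close>, with value 1 at 0.
  The integrand is continuous in \<open>t\<close>, so the Henstock-Kurzweil integral below is the
  Riemann integral.
\<close>

definition eps_n :: "nat \<Rightarrow> real" where
  "eps_n n = real n * integral {0..r_n n} (\<lambda>t.
     t * P_n n t ^ 2 * cos (sqrt (3 / (2 * real n)) * t)
       * sinc (sqrt ((real n + 1) / (2 * real n)) * t) ^ (n - 1))"

lemma E_n_pos:
  assumes "n \<ge> 2"
  shows "E_n n > 0"
proof -
  have "0 \<le> 17 * real n ^ 2 - 26 * real n + 9"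
  proof -
    have "17 * real n ^ 2 - 26 * real n + 9 = (17 * real n - 9) * (real n - 1)"
      by (simp add: algebra_simps power2_eq_square)
    then show ?thesis
      using assms by simp
  qed
  then have "gamma_n n \<ge> 0"
    by (simp add: gamma_n_def)
  then have "D_n n > 0"
    by (simp add: D_n_def L_n_def add_nonneg_pos)
  then show ?thesis
    by (simp add: E_n_def)
qed

lemma r_n_pos:
  assumes "n \<ge> 2"
  shows "r_n n > 0"
proof -
  have "sigma_n n > 0"
    using assms by (simp add: sigma_n_def)
  then show ?thesis
    using E_n_pos[OF assms] by (simp add: r_n_def add_pos_nonneg)
qed

lemma P_n_r_n_eq_0:
  assumes "n \<ge> 2"
  shows "P_n n (r_n n) = 0"
proof -
  define S where "S = sqrt (E_n n ^ 2 + sigma_n n / (4 * real n))"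
  have s: "sigma_n n > 0"
    using assms by (simp add: sigma_n_def)
  have n: "real n > 0"
    using assms by simp
  have S2: "S ^ 2 = E_n n ^ 2 + sigma_n n / (4 * real n)"
    unfolding S_def using s n by (intro real_sqrt_pow2) simp
  have "S \<ge> 0"
    unfolding S_def using s n by simp
  then have q: "E_n n + S > 0"
    using E_n_pos[OF assms] by simp
  have sg: "sigma_n n = 4 * real n * (S - E_n n) * (S + E_n n)"
    using S2 n by (simp add: field_simps power2_eq_square)
  have "r_n n = 2 * sigma_n n / (E_n n + S)"
    by (simp add: r_n_def S_def)
  also have "\<dots> = 8 * real n * (S - E_n n)"
    unfolding sg using q by (simp add: field_simps)
  finally have rr: "r_n n = 8 * real n * (S - E_n n)" .
  show ?thesis
    unfolding P_n_def sg rr using n by (simp add: field_simps power2_eq_square)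
qed

lemma P_n_eq_0_iff:
  assumes "n \<ge> 2" and "t > 0"
  shows "P_n n t = 0 \<longleftrightarrow> t = r_n n"
proof -
  have mono: "P_n n y < P_n n x" if "0 < x" "x < y" for x y
  proof -
    have "E_n n * x < E_n n * y" "x ^ 2 \<le> y ^ 2"
      using E_n_pos[OF assms(1)] that by (simp_all add: power_mono)
    then have "x ^ 2 / (16 * real n) \<le> y ^ 2 / (16 * real n)"
      by (intro divide_right_mono) simp_all
    then show ?thesis
      using \<open>E_n n * x < E_n n * y\<close> by (simp add: P_n_def)
  qed
  show ?thesis
    using mono[of t "r_n n"] mono[of "r_n n" t] P_n_r_n_eq_0[OF assms(1)] r_n_pos[OF assms(1)] assms(2)
    by (cases t "r_n n" rule: linorder_cases) auto
qed

end

theory Submission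
  imports Defs
begin

text \<open>
  The interval of integration is short: \<^term>\<open>r_n n\<close> is about
  \<^term>\<open>sigma_n n / E_n n\<close>, which is below \<open>1/5\<close> and tends to \<open>0\<close>.  On it the trigonometric
  weight is close to 1, and the quadratic term of \<^term>\<open>P_n n t\<close> is small against the linear one.
  So the integral is nearly that of \<open>t * (sigma - E * t)\<^sup>2\<close> up to \<open>sigma / E\<close>, which equals
  \<open>sigma^4 / (12 * E\<^sup>2)\<close>, and since \<open>sigma\<^sup>2 = 1 / (2 * n * (n + 2))\<close> this gives
  \<open>eps \<approx> 1 / (48 * E\<^sup>2 * n * (n + 2)\<^sup>2)\<close>.  The coefficient \<open>E\<close> hardly varies with \<open>n\<close>:
  it lies between \<open>1.472\<close> and \<open>1.505\<close> (lemma \<open>E_n_bounds\<close>), and these two numbers place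
  \<open>48 * E\<^sup>2\<close> strictly between 104 and 110.

  For the upper bound, dropping the quadratic term, bounding the weight by 1 and lengthening the
  interval only increase the integral, and \<open>48 * 1.472\<^sup>2 > 104\<close>.  For the lower bound, the quadratic
  term is absorbed into a slightly steeper line of slope \<open>1.511\<close>, the interval is cut at the zero of
  that line, and the weight is bounded below by \<open>1 - c * t\<^sup>2\<close>, where the Taylor coefficients of
  cosine and sine give \<open>c = (n\<^sup>2 + 8) / (12 * n)\<close>.  With these uniform
  constants both losses are largest for \<open>n = 2\<close>, and together they stay below the gap between
  \<open>48 * 1.505\<^sup>2\<close> and 110.
\<close>

section \<open>Bounds for the trigonometric weight\<close>

lemma cos_ge_one_minus_half_square: "1 - x\<^sup>2 / 2 \<le> cos x" for x :: real
proof -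
  have "\<bar>sin (x / 2)\<bar>\<^sup>2 \<le> \<bar>x / 2\<bar>\<^sup>2"
    by (intro power_mono abs_sin_x_le_abs_x) simp
  then have "(sin (x / 2))\<^sup>2 \<le> x\<^sup>2 / 4"
    by (simp add: power_divide)
  moreover have "cos x = 1 - 2 * (sin (x / 2))\<^sup>2"
    using cos_double_sin[of "x / 2"] by simp
  ultimately show ?thesis
    by simp
qed

lemma sin_ge_cubic:
  fixes x :: real
  assumes "0 \<le> x"
  shows "x - x ^ 3 / 6 \<le> sin x"
proof -
  define f :: "real \<Rightarrow> real" where "f = (\<lambda>x. sin x - x + x ^ 3 / 6)"
  have "f 0 \<le> f x"
  proof (rule DERIV_nonneg_imp_nondecreasing[OF assms])
    fix y :: real
    have "(f has_real_derivative cos y - 1 + y\<^sup>2 / 2) (at y)"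
      unfolding f_def by (auto intro!: derivative_eq_intros)
    moreover have "0 \<le> cos y - 1 + y\<^sup>2 / 2"
      using cos_ge_one_minus_half_square[of y] by simp
    ultimately show "\<exists>d. (f has_real_derivative d) (at y) \<and> 0 \<le> d"
      by blast
  qed
  then show ?thesis
    by (simp add: f_def)
qed

lemma sinc_ge_one_minus_sixth_square:
  assumes "0 \<le> x"
  shows "1 - x\<^sup>2 / 6 \<le> sinc x"
proof (cases "x = 0")
  case False
  then have "(x - x ^ 3 / 6) / x \<le> sin x / x"
    using sin_ge_cubic[OF assms] assms by (intro divide_right_mono) auto
  moreover have "(x - x ^ 3 / 6) / x = 1 - x\<^sup>2 / 6"
    using False by (simp add: field_simps power2_eq_square power3_eq_cube)
  ultimately show ?thesis
    using False by simp
qed simp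

lemma sinc_le_one:
  assumes "0 \<le> x"
  shows "sinc x \<le> 1"
  using sin_x_le_x[OF assms] assms by (auto simp: divide_le_eq_1)

definition weight :: "nat \<Rightarrow> real \<Rightarrow> real" where
  "weight n t = cos (sqrt (3 / (2 * real n)) * t)
     * sinc (sqrt ((real n + 1) / (2 * real n)) * t) ^ (n - 1)"

text \<open>
  The quadratic coefficient adds up those of the factors: \<open>a\<^sup>2 / 2 = 3 / (4 * n)\<close> from the cosine,
  and \<open>(n - 1) * b\<^sup>2 / 6 = (n\<^sup>2 - 1) / (12 * n)\<close> from the power of sinc, through Bernoulli's
  inequality.
\<close>

lemma weight_bounds:
  assumes "n \<ge> 2" and "0 \<le> t" and "t \<le> 1"
  shows "0 \<le> weight n t" and "weight n t \<le> 1"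
    and "1 - ((real n)\<^sup>2 + 8) / (12 * real n) * t\<^sup>2 \<le> weight n t"
proof -
  define u where "u = sqrt (3 / (2 * real n)) * t"
  define v where "v = sqrt ((real n + 1) / (2 * real n)) * t"
  define p where "p = u\<^sup>2 / 2"
  define q where "q = real (n - 1) * (v\<^sup>2 / 6)"
  have n: "real n \<ge> 2"
    using assms by simp
  have v0: "0 \<le> v"
    using n assms by (simp add: v_def)
  have u2: "u\<^sup>2 = 3 / (2 * real n) * t\<^sup>2" and v2: "v\<^sup>2 = (real n + 1) / (2 * real n) * t\<^sup>2"
    using n by (simp_all add: u_def v_def power_mult_distrib)
  have t2: "0 \<le> t\<^sup>2" "t\<^sup>2 \<le> 1"
    using assms by (simp_all add: power_le_one)
  have "u\<^sup>2 \<le> 1 * 1"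
    unfolding u2 using n t2 by (intro mult_mono) (auto simp: field_simps)
  then have p: "0 \<le> p" "p \<le> 1"
    by (simp_all add: p_def)
  have vle: "v\<^sup>2 \<le> 1 * 1"
    unfolding v2 using n t2 by (intro mult_mono) (auto simp: field_simps)
  have cos: "1 - p \<le> cos u"
    using cos_ge_one_minus_half_square[of u] by (simp add: p_def)
  have sinc: "1 - v\<^sup>2 / 6 \<le> sinc v" "sinc v \<le> 1"
    using sinc_ge_one_minus_sixth_square[OF v0] sinc_le_one[OF v0] by auto
  have sinc0: "0 \<le> sinc v"
    using sinc(1) vle by linarith
  have "1 - q \<le> (1 - v\<^sup>2 / 6) ^ (n - 1)"
    using Bernoulli_inequality[of "- (v\<^sup>2 / 6)" "n - 1"] vle by (simp add: q_def)
  also have "\<dots> \<le> sinc v ^ (n - 1)"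
    using sinc(1) vle by (intro power_mono) auto
  finally have pow: "1 - q \<le> sinc v ^ (n - 1)" .
  have pow1: "0 \<le> sinc v ^ (n - 1)" "sinc v ^ (n - 1) \<le> 1"
    using sinc(2) sinc0 by (auto intro: power_le_one zero_le_power)
  have w: "weight n t = cos u * sinc v ^ (n - 1)"
    by (simp add: weight_def u_def v_def)
  show "0 \<le> weight n t"
    unfolding w using cos p pow1 by (intro mult_nonneg_nonneg) auto
  show "weight n t \<le> 1"
    unfolding w using pow1 by (intro mult_le_one) auto
  have "p + q = ((real n)\<^sup>2 + 8) / (12 * real n) * t\<^sup>2"
  proof -
    have "3 / (2 * N) * T / 2 + (N - 1) * ((N + 1) / (2 * N) * T / 6) = (N\<^sup>2 + 8) / (12 * N) * T"
      if "N > 0" for N T :: real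
      using that by (simp add: field_simps power2_eq_square)
    moreover have "real (n - 1) = real n - 1"
      using assms(1) by simp
    ultimately show ?thesis
      using n unfolding p_def q_def u2 v2 by simp
  qed
  moreover have "1 - (p + q) \<le> weight n t"
  proof -
    \<comment> \<open>Writing the weight as \<open>y - (1 - x) * y\<close> avoids asking for the sign of \<open>1 - q\<close>,
      which may be negative for large \<open>n\<close>.\<close>
    have "(1 - cos u) * sinc v ^ (n - 1) \<le> (1 - cos u) * 1"
      using pow1 by (intro mult_left_mono) auto
    then show ?thesis
      unfolding w using cos pow by (simp add: algebra_simps)
  qed
  ultimately show "1 - ((real n)\<^sup>2 + 8) / (12 * real n) * t\<^sup>2 \<le> weight n t"
    by simp
qed

section \<open>Bounds for the coefficients of the quadratic\<close>

text \<open>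
  The square root is at most \<open>4.1232 * n - 3\<close>, a line slightly steeper than \<open>sqrt 17 * n\<close> whose
  constant term cancels the 3 in the numerator.  The resulting bound exceeds the limit
  \<open>(1 + sqrt 17) / 2\<close> of the sequence by less than \<open>1 / 10000\<close>.
\<close>

lemma gamma_n_bounds:
  assumes "n \<ge> 2"
  shows "3 / 2 \<le> gamma_n n" and "gamma_n n \<le> 2.5616"
proof -
  define R where "R = sqrt (17 * real n ^ 2 - 26 * real n + 9)"
  have n: "real n \<ge> 2"
    using assms by simp
  have n2: "2 * real n \<le> real n * real n"
    using n by simp
  have "2 * real n \<le> R"
    unfolding R_def using n2 by (intro real_le_rsqrt) (simp add: power2_eq_square)
  then have lo: "3 / 2 \<le> (real n + 3 + R) / (2 * real n)"
    using n by (simp add: field_simps)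
  have "R \<le> 4.1232 * real n - 3"
    unfolding R_def
  proof (rule real_le_lsqrt)
    have "(4.1232 * real n - 3)\<^sup>2 - (17 * real n ^ 2 - 26 * real n + 9)
        = 0.00077824 * real n ^ 2 + 1.2608 * real n"
      by (simp add: power2_eq_square algebra_simps)
    also have "\<dots> \<ge> 0"
      by simp
    finally show "17 * real n ^ 2 - 26 * real n + 9 \<le> (4.1232 * real n - 3)\<^sup>2"
      by simp
  qed (use n in simp)
  then have hi: "(real n + 3 + R) / (2 * real n) \<le> 2.5616"
    using n by (simp add: field_simps)
  show "3 / 2 \<le> gamma_n n" "gamma_n n \<le> 2.5616"
    using lo hi by (auto simp: gamma_n_def R_def)
qed

text \<open>
  The lower bound has to exceed \<open>sqrt (104 / 48) = 1.47196...\<close>; it is nearly attained at \<open>n = 2\<close>,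
  where \<open>E = 1.47244...\<close>, so the constant 104 leaves almost no room.  The upper bound is close to
  the limit \<open>1.5047...\<close> for large \<open>n\<close>.
\<close>

lemma E_n_bounds:
  assumes "n \<ge> 2"
  shows "1.472 \<le> E_n n" and "E_n n \<le> 1.505"
proof -
  have L: "14.5 \<le> L_n n" "L_n n \<le> 15.5616"
    using gamma_n_bounds[OF assms] by (auto simp: L_n_def)
  have sL: "3.8078 \<le> sqrt (L_n n)" "sqrt (L_n n) \<le> 3.945"
    using L by - (rule real_le_rsqrt real_le_lsqrt; simp add: power2_eq_square)+
  have s3: "1.732 \<le> sqrt 3" "sqrt 3 \<le> (1.73206 :: real)"
    by (rule real_le_rsqrt real_le_lsqrt; simp add: power2_eq_square)+
  have s2: "1.41421 \<le> sqrt 2" "sqrt 2 \<le> (1.41422 :: real)"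
    by (rule real_le_rsqrt real_le_lsqrt; simp add: power2_eq_square)+
  have "3.916 \<le> D_n n"
    unfolding D_n_def using sL s3 s2 by (simp add: pos_le_divide_eq)
  moreover have "D_n n \<le> 4.0145"
    unfolding D_n_def using sL s3 s2 by (simp add: pos_divide_le_eq)
  ultimately show "1.472 \<le> E_n n" "E_n n \<le> 1.505"
    by (auto simp: E_n_def)
qed

lemma sigma_n_bounds:
  assumes "n \<ge> 2"
  shows "0 < sigma_n n" and "sigma_n n \<le> 1 / 4"
    and "(sigma_n n)\<^sup>2 = 1 / (2 * real n * (real n + 2))"
proof -
  have n: "real n \<ge> 2"
    using assms by simp
  show pos: "0 < sigma_n n"
    using n by (simp add: sigma_n_def)
  show sq: "(sigma_n n)\<^sup>2 = 1 / (2 * real n * (real n + 2))"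
    using n by (simp add: sigma_n_def power_divide)
  have "2 * 4 \<le> real n * (real n + 2)"
    using n by (intro mult_mono) auto
  then have "(sigma_n n)\<^sup>2 \<le> (1 / 4)\<^sup>2"
    unfolding sq by (simp add: field_simps power2_eq_square)
  then show "sigma_n n \<le> 1 / 4"
    by (rule power2_le_imp_le) simp
qed

lemma P_n_nonneg_iff:
  assumes "n \<ge> 2" and "0 \<le> t"
  shows "0 \<le> P_n n t \<longleftrightarrow> t \<le> r_n n"
proof -
  have mono: "P_n n y < P_n n x" if "0 \<le> x" "x < y" for x y
  proof -
    have "E_n n * x < E_n n * y"
      using E_n_pos[OF assms(1)] that by simp
    moreover have "x ^ 2 / (16 * real n) \<le> y ^ 2 / (16 * real n)"
      using that by (intro divide_right_mono power_mono) auto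
    ultimately show ?thesis
      by (simp add: P_n_def)
  qed
  show ?thesis
    using mono[of t "r_n n"] mono[of "r_n n" t] P_n_r_n_eq_0[OF assms(1)] r_n_pos[OF assms(1)]
      assms(2)
    by (cases t "r_n n" rule: linorder_cases) auto
qed

lemma r_n_le:
  assumes "n \<ge> 2"
  shows "r_n n \<le> sigma_n n / 1.472"
proof -
  have "1.472 * r_n n \<le> E_n n * r_n n"
    using E_n_bounds[OF assms] r_n_pos[OF assms] by (intro mult_right_mono) auto
  also have "\<dots> = sigma_n n - (r_n n)\<^sup>2 / (16 * real n)"
    using P_n_r_n_eq_0[OF assms] by (simp add: P_n_def)
  also have "\<dots> \<le> sigma_n n"
    by simp
  finally show ?thesis
    by (simp add: field_simps)
qed

section \<open>The comparison integrals\<close>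

text \<open>
  Taking \<open>c = 0\<close> gives the unweighted integral of the upper bound.  In the lower bound, the term
  with \<open>c\<close> accounts for the weight: relative to the main term it costs only \<open>c * s\<^sup>2 / 5\<close>.
\<close>

lemma has_integral_line_squared:
  fixes F s c :: real
  assumes "0 \<le> s"
  shows "((\<lambda>t. t * (F * (s - t))\<^sup>2 * (1 - c * t\<^sup>2))
    has_integral F\<^sup>2 * (s ^ 4 / 12 - c * s ^ 6 / 60)) {0..s}"
proof -
  define G where "G = (\<lambda>t. F\<^sup>2 * (s\<^sup>2 * t\<^sup>2 / 2 - 2 * s * t ^ 3 / 3 + t ^ 4 / 4
    - c * (s\<^sup>2 * t ^ 4 / 4 - 2 * s * t ^ 5 / 5 + t ^ 6 / 6)))"
  have "(G has_vector_derivative t * (F * (s - t))\<^sup>2 * (1 - c * t\<^sup>2)) (at t within {0..s})" for t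
    unfolding G_def has_real_derivative_iff_has_vector_derivative[symmetric]
    by (auto intro!: derivative_eq_intros simp: field_simps power2_eq_square eval_nat_numeral)
  then have "((\<lambda>t. t * (F * (s - t))\<^sup>2 * (1 - c * t\<^sup>2)) has_integral G s - G 0) {0..s}"
    using assms by (intro fundamental_theorem_of_calculus) auto
  moreover have "G s - G 0 = F\<^sup>2 * (s ^ 4 / 12 - c * s ^ 6 / 60)"
    by (simp add: G_def field_simps eval_nat_numeral)
  ultimately show ?thesis
    by simp
qed

lemma continuous_on_weight: "continuous_on A (weight n)"
  unfolding weight_def
proof (intro continuous_on_mult continuous_on_power continuous_on_cos continuous_on_sinc)
qed (intro continuous_intros)+

lemma integrable_eps_integrand: "(\<lambda>t. t * (P_n n t)\<^sup>2 * weight n t) integrable_on {a..b}"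
proof -
  have "continuous_on {a..b} (\<lambda>t. t * (P_n n t)\<^sup>2)"
    unfolding P_n_def by (cases "n = 0") (auto intro!: continuous_intros)
  then show ?thesis
    by (rule integrable_continuous_real[OF continuous_on_mult[OF _ continuous_on_weight]])
qed

lemma eps_n_eq: "eps_n n = real n * integral {0..r_n n} (\<lambda>t. t * (P_n n t)\<^sup>2 * weight n t)"
  unfolding eps_n_def weight_def mult.assoc ..

lemma eps_n_le:
  assumes "n \<ge> 2"
  shows "eps_n n \<le> real n * (sigma_n n ^ 4 / (12 * 1.472\<^sup>2))"
proof -
  define s where "s = sigma_n n / 1.472"
  define g where "g = (\<lambda>t. t * (1.472 * (s - t))\<^sup>2)"
  have s: "sigma_n n = 1.472 * s" "0 \<le> s" "s \<le> 1"
    using sigma_n_bounds[OF assms] by (auto simp: s_def)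
  have rs: "r_n n \<le> s"
    using r_n_le[OF assms] by (simp add: s_def)
  have g: "(g has_integral 1.472\<^sup>2 * (s ^ 4 / 12)) {0..s}"
    using has_integral_line_squared[OF s(2), of "1.472" 0] by (simp add: g_def)
  have "integral {0..r_n n} (\<lambda>t. t * (P_n n t)\<^sup>2 * weight n t) \<le> integral {0..r_n n} g"
  proof (rule integral_le[OF integrable_eps_integrand])
    show "g integrable_on {0..r_n n}"
      unfolding g_def by (intro integrable_continuous_real continuous_intros)
    fix t assume "t \<in> {0..r_n n}"
    then have t: "0 \<le> t" "t \<le> r_n n" "t \<le> 1"
      using rs s by auto
    have "1.472 * t \<le> E_n n * t"
      using E_n_bounds[OF assms] t by (intro mult_right_mono) auto
    then have "P_n n t \<le> 1.472 * (s - t)"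
      by (simp add: P_n_def s(1) algebra_simps add_nonneg_nonneg add_increasing2)
    then have "(P_n n t)\<^sup>2 \<le> (1.472 * (s - t))\<^sup>2"
      using P_n_nonneg_iff[OF assms t(1)] t by (intro power_mono) auto
    then have "t * (P_n n t)\<^sup>2 * weight n t \<le> t * (1.472 * (s - t))\<^sup>2 * 1"
      using weight_bounds[OF assms t(1,3)] t by (intro mult_mono) auto
    then show "t * (P_n n t)\<^sup>2 * weight n t \<le> g t"
      by (simp add: g_def)
  qed
  also have "\<dots> \<le> integral {0..s} g"
    using rs g by (intro integral_subset_le)
      (auto simp: g_def intro!: integrable_continuous_real continuous_intros)
  also have "\<dots> = sigma_n n ^ 4 / (12 * 1.472\<^sup>2)"
    using g by (simp add: integral_unique s(1) power_mult_distrib power2_eq_square eval_nat_numeral)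
  finally show ?thesis
    unfolding eps_n_eq by (intro mult_left_mono) auto
qed

text \<open>
  The slope \<open>1.511\<close> leaves room for the quadratic term: below the zero of the line,
  \<open>t / (16 * n) \<le> (1/4) / (1.511 * 32) < 1.511 - 1.505\<close>.
\<close>

lemma eps_n_ge:
  fixes n :: nat
  defines "s \<equiv> sigma_n n / 1.511"
  defines "c \<equiv> ((real n)\<^sup>2 + 8) / (12 * real n)"
  assumes "n \<ge> 2"
  shows "real n * (1.511\<^sup>2 * (s ^ 4 / 12 - c * s ^ 6 / 60)) \<le> eps_n n"
proof -
  define h where "h = (\<lambda>t. t * (1.511 * (s - t))\<^sup>2 * (1 - c * t\<^sup>2))"
  have n: "real n \<ge> 2"
    using assms by simp
  have s: "sigma_n n = 1.511 * s" "0 \<le> s" "s \<le> 0.166"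
    using sigma_n_bounds[OF assms(3)] by (auto simp: s_def)
  have line: "1.511 * (s - t) \<le> P_n n t" if t: "0 \<le> t" "t \<le> s" for t
  proof -
    have "t / (16 * real n) \<le> 0.166 / (16 * 2)"
      using t s n by (intro frac_le) auto
    then have "E_n n + t / (16 * real n) \<le> 1.511"
      using E_n_bounds[OF assms(3)] by simp
    then have "(E_n n + t / (16 * real n)) * t \<le> 1.511 * t"
      using t by (intro mult_right_mono) auto
    moreover have "P_n n t = sigma_n n - (E_n n + t / (16 * real n)) * t"
      by (simp add: P_n_def distrib_right power2_eq_square)
    ultimately show ?thesis
      unfolding s(1) by (simp add: right_diff_distrib)
  qed
  have rs: "s \<le> r_n n"
    using line[of s] P_n_nonneg_iff[OF assms(3), of s] s by simp
  have r1: "r_n n \<le> 1"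
    using r_n_le[OF assms(3)] sigma_n_bounds[OF assms(3)] by simp
  have h: "(h has_integral 1.511\<^sup>2 * (s ^ 4 / 12 - c * s ^ 6 / 60)) {0..s}"
    unfolding h_def by (rule has_integral_line_squared[OF s(2)])
  have "1.511\<^sup>2 * (s ^ 4 / 12 - c * s ^ 6 / 60) = integral {0..s} h"
    using h by (simp add: integral_unique)
  also have "\<dots> \<le> integral {0..s} (\<lambda>t. t * (P_n n t)\<^sup>2 * weight n t)"
  proof (rule integral_le[OF _ integrable_eps_integrand])
    show "h integrable_on {0..s}"
      using h by blast
    fix t assume "t \<in> {0..s}"
    then have t: "0 \<le> t" "t \<le> s" "t \<le> 1"
      using s by auto
    have "h t \<le> t * (1.511 * (s - t))\<^sup>2 * weight n t"
      unfolding h_def using weight_bounds[OF assms(3) t(1,3)] t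
      by (intro mult_left_mono) (auto simp: c_def)
    also have "\<dots> \<le> t * (P_n n t)\<^sup>2 * weight n t"
      using weight_bounds[OF assms(3) t(1,3)] t line[OF t(1,2)]
      by (intro mult_right_mono mult_left_mono power_mono) auto
    finally show "h t \<le> t * (P_n n t)\<^sup>2 * weight n t" .
  qed
  also have "\<dots> \<le> integral {0..r_n n} (\<lambda>t. t * (P_n n t)\<^sup>2 * weight n t)"
    using rs r1 weight_bounds(1)[OF assms(3)]
    by (intro integral_subset_le integrable_eps_integrand) auto
  finally show ?thesis
    unfolding eps_n_eq by (intro mult_left_mono) auto
qed

section \<open>The estimate\<close>

theorem propositionA1:
  fixes n :: nat
  assumes "n \<ge> 2"
  shows "1 / (110 * real n * (real n + 2) ^ 2) < eps_n n
       \<and> eps_n n < 1 / (104 * real n * (real n + 2) ^ 2)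
       \<and> eps_n n > 1 / (440 * real n ^ 3)"
proof -
  define X where "X = 1 / (real n * (real n + 2)\<^sup>2)"
  define s where "s = sigma_n n / 1.511"
  define c where "c = ((real n)\<^sup>2 + 8) / (12 * real n)"
  have n: "real n \<ge> 2"
    using assms by simp
  have X: "X > 0"
    using n by (simp add: X_def)
  have "sigma_n n ^ 4 = ((sigma_n n)\<^sup>2)\<^sup>2"
    by simp
  then have "real n * sigma_n n ^ 4 = real n / (2 * real n * (real n + 2))\<^sup>2"
    unfolding sigma_n_bounds(3)[OF assms] by (simp add: power_divide)
  also have "\<dots> = X / 4"
    using n by (simp add: X_def power2_eq_square)
  finally have s4: "real n * sigma_n n ^ 4 = X / 4" .

  have "eps_n n \<le> (real n * sigma_n n ^ 4) / (12 * 1.472\<^sup>2)"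
    using eps_n_le[OF assms] by simp
  also have "\<dots> < X / 104"
    unfolding s4 using X by (simp add: power2_eq_square)
  finally have upper: "eps_n n < X / 104" .

  \<comment> \<open>The quotient \<open>(n\<^sup>2 + 8) / (24 * n\<^sup>2 * (n + 2))\<close> is largest at \<open>n = 2\<close>, with value \<open>1 / 32\<close>, and
    \<open>1 / (32 * 1.511\<^sup>2) < 0.014\<close>.\<close>
  have cs: "c * s\<^sup>2 \<le> 0.014"
  proof -
    have "c * s\<^sup>2 = ((real n)\<^sup>2 + 8) / (24 * (real n)\<^sup>2 * (real n + 2)) / 1.511\<^sup>2"
      unfolding c_def s_def power_divide sigma_n_bounds(3)[OF assms]
      by (simp add: power2_eq_square mult_ac)
    also have "((real n)\<^sup>2 + 8) / (24 * (real n)\<^sup>2 * (real n + 2)) \<le> 1 / 32"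
    proof -
      have "(real n)\<^sup>2 \<ge> 4"
        using power_mono[OF n, of 2] by simp
      then have "32 * ((real n)\<^sup>2 + 8) \<le> 24 * (real n)\<^sup>2 * 4"
        by simp
      also have "\<dots> \<le> 24 * (real n)\<^sup>2 * (real n + 2)"
        using n by (intro mult_left_mono) auto
      finally show ?thesis
        using n by (simp add: divide_le_eq)
    qed
    finally show ?thesis
      by (simp add: power2_eq_square)
  qed
  have "X / 110 < (real n * sigma_n n ^ 4) / (12 * 1.511\<^sup>2) * (1 - 0.014 / 5)"
    unfolding s4 using X by (simp add: power2_eq_square)
  also have "\<dots> \<le> (real n * sigma_n n ^ 4) / (12 * 1.511\<^sup>2) * (1 - c * s\<^sup>2 / 5)"
    using cs by (intro mult_left_mono) auto
  also have "\<dots> = real n * (1.511\<^sup>2 * (s ^ 4 / 12 - c * s ^ 6 / 60))"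
    by (simp add: s_def field_simps eval_nat_numeral)
  also have "\<dots> \<le> eps_n n"
    using eps_n_ge[OF assms] by (simp add: s_def c_def)
  finally have lower: "X / 110 < eps_n n" .

  have "(real n + 2)\<^sup>2 \<le> (2 * real n)\<^sup>2"
    using n by (intro power_mono) auto
  then have "110 * real n * (real n + 2)\<^sup>2 \<le> 110 * real n * (2 * real n)\<^sup>2"
    by (intro mult_left_mono) auto
  then have "110 * real n * (real n + 2)\<^sup>2 \<le> 440 * real n ^ 3"
    by (simp add: power2_eq_square power3_eq_cube)
  then have "1 / (440 * real n ^ 3) \<le> 1 / (110 * real n * (real n + 2)\<^sup>2)"
    using n by (intro divide_left_mono) auto
  with lower upper show ?thesis
    by (simp add: X_def mult.assoc)
qed

end
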